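(* Let $\perp$ be an interference relation on a restriction category $\mathbb{X}$ with restriction zeroes. Then, for maps $f$, $g$ with the same domain $A$: (i) for all maps $f$, $f\perp0$; (ii) if $f\perp g$ then $\overline{f}g=0$, $\overline{g}f=0$, and $\overline{f}\,\overline{g}=0$; (iii) if $f$ is total, then $f\perp g$ if and only if $g=0$; (iv) if $e:A\to A$ is a restriction idempotent, then $e\perp f$ if and only if $e\perp\overline{f}$; (v) if $f\perp g$, then $f\perp\overline{g}$ and $\overline{f}\perp g$.
   Context: Composition is diagrammatic: $fg$ means first $f$, then $g$. A restriction category is a category with an operator sending each $f:A\to B$ to $\overline{f}:A\to A$ such that $\overline{f}f=f$; $\overline{f}\,\overline{g}=\overline{g}\,\overline{f}$ and $\overline{\overline{g}f}=\overline{g}\,\overline{f}$ for $f:A\to B$, $g:A\to C$; and $f\overline{g}=\overline{fg}f$ for $f:A\to B$, $g:B\to C$. For parallel $f,g$: $f\le g$ iff $\overline{f}g=f$. A map $f:A\to B$ is total if $\overline{f}=1_A$; a restriction idempotent is a map $e:A\to A$ with $\overline{e}=e$. Restriction zeroes: maps $0:A\to B$ with $f0=0=0f$ and $\overline{0}=0$. An interference relation $\perp$ is a family of relations between maps with the same domain ($f:A\to B$, $g:A\to C$) such that: $1_A\perp 0$; $f\perp g\Rightarrow g\perp f$; $f\perp f\Rightarrow f=0$; $f'\perp g'$, $f\le f'$, $g\le g'$ imply $f\perp g$; $f\perp g\Rightarrow hfk\perp hgk'$ for all composable $h,k,k'$; $f\perp g\Rightarrow\overline{f}\perp\overline{g}$.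 *)

theory Defs
  imports Main
begin

text \<open>
  Composition is diagrammatic: \<open>f \<cdot> g\<close> means first \<open>f\<close>, then \<open>g\<close>.
  All operations are total HOL functions, constrained only on objects, arrows and
  composable pairs; their values elsewhere are arbitrary.
\<close>

record ('o, 'm) category =
  obj :: "'o set"
  arr :: "'m set"
  src :: "'m \<Rightarrow> 'o"
  tgt :: "'m \<Rightarrow> 'o"
  idn :: "'o \<Rightarrow> 'm"  ("\<one>\<index>")
  cmp :: "'m \<Rightarrow> 'm \<Rightarrow> 'm"  (infixl "\<cdot>\<index>" 70)

definition hom :: "('o, 'm, 'z) category_scheme \<Rightarrow> 'o \<Rightarrow> 'o \<Rightarrow> 'm set"  ("hom\<index>")
  where "hom\<^bsub>X\<^esub> A B = {f \<in> arr X. src X f = A \<and> tgt X f = B}"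

locale category =
  fixes X (structure)
  assumes src_obj: "f \<in> arr X \<Longrightarrow> src X f \<in> obj X"
    and tgt_obj: "f \<in> arr X \<Longrightarrow> tgt X f \<in> obj X"
    and idn_hom: "A \<in> obj X \<Longrightarrow> \<one> A \<in> hom A A"
    and cmp_hom: "\<lbrakk>f \<in> hom A B; g \<in> hom B C\<rbrakk> \<Longrightarrow> f \<cdot> g \<in> hom A C"
    and idn_left: "f \<in> hom A B \<Longrightarrow> \<one> A \<cdot> f = f"
    and idn_right: "f \<in> hom A B \<Longrightarrow> f \<cdot> \<one> B = f"
    and assoc: "\<lbrakk>f \<in> hom A B; g \<in> hom B C; h \<in> hom C D\<rbrakk> \<Longrightarrow> f \<cdot> g \<cdot> h = f \<cdot> (g \<cdot> h)"

record ('o, 'm) restriction_category = "('o, 'm) category" +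
  rst :: "'m \<Rightarrow> 'm"  ("\<rho>\<index>")

text \<open>\<open>\<rho> f\<close> is the restriction of \<open>f\<close>, usually written as \<open>f\<close> with an overline.\<close>

locale restriction_category = category +
  assumes rst_hom: "f \<in> hom A B \<Longrightarrow> \<rho> f \<in> hom A A"
    and rst_cmp_self: "f \<in> hom A B \<Longrightarrow> \<rho> f \<cdot> f = f"
    and rst_commute: "\<lbrakk>f \<in> hom A B; g \<in> hom A C\<rbrakk> \<Longrightarrow> \<rho> f \<cdot> \<rho> g = \<rho> g \<cdot> \<rho> f"
    and rst_rst_cmp: "\<lbrakk>f \<in> hom A B; g \<in> hom A C\<rbrakk> \<Longrightarrow> \<rho> (\<rho> g \<cdot> f) = \<rho> g \<cdot> \<rho> f"
    and cmp_rst: "\<lbrakk>f \<in> hom A B; g \<in> hom B C\<rbrakk> \<Longrightarrow> f \<cdot> \<rho> g = \<rho> (f \<cdot> g) \<cdot> f"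

definition restriction_le ::
    "('o, 'm, 'z) restriction_category_scheme \<Rightarrow> 'm \<Rightarrow> 'm \<Rightarrow> bool"  (infix "\<sqsubseteq>\<index>" 50)
  where "f \<sqsubseteq>\<^bsub>X\<^esub> g \<longleftrightarrow> (\<exists>A B. f \<in> hom\<^bsub>X\<^esub> A B \<and> g \<in> hom\<^bsub>X\<^esub> A B) \<and> \<rho>\<^bsub>X\<^esub> f \<cdot>\<^bsub>X\<^esub> g = f"

definition total_map :: "('o, 'm, 'z) restriction_category_scheme \<Rightarrow> 'm \<Rightarrow> bool"
  where "total_map X f \<longleftrightarrow> f \<in> arr X \<and> \<rho>\<^bsub>X\<^esub> f = \<one>\<^bsub>X\<^esub> (src X f)"

definition restriction_idempotent :: "('o, 'm, 'z) restriction_category_scheme \<Rightarrow> 'm \<Rightarrow> bool"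
  where "restriction_idempotent X e \<longleftrightarrow> (\<exists>A. e \<in> hom\<^bsub>X\<^esub> A A) \<and> \<rho>\<^bsub>X\<^esub> e = e"

record ('o, 'm) restriction_zero_category = "('o, 'm) restriction_category" +
  zer :: "'o \<Rightarrow> 'o \<Rightarrow> 'm"  ("\<zero>\<index>")

locale restriction_zero_category = restriction_category +
  assumes zer_hom: "\<lbrakk>A \<in> obj X; B \<in> obj X\<rbrakk> \<Longrightarrow> \<zero> A B \<in> hom A B"
    and cmp_zer: "\<lbrakk>f \<in> hom A B; C \<in> obj X\<rbrakk> \<Longrightarrow> f \<cdot> \<zero> B C = \<zero> A C"
    and zer_cmp: "\<lbrakk>f \<in> hom B C; A \<in> obj X\<rbrakk> \<Longrightarrow> \<zero> A B \<cdot> f = \<zero> A C"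
    and rst_zer: "\<lbrakk>A \<in> obj X; B \<in> obj X\<rbrakk> \<Longrightarrow> \<rho> (\<zero> A B) = \<zero> A A"

text \<open>
  Only pairs of arrows with the same source matter for \<open>\<bottom>\<close>; its values on other pairs
  are unconstrained.
\<close>

locale interference_relation = restriction_zero_category +
  fixes perp :: "'b \<Rightarrow> 'b \<Rightarrow> bool"  (infix "\<bottom>" 50)
  assumes perp_idn_zer: "\<lbrakk>A \<in> obj X; B \<in> obj X\<rbrakk> \<Longrightarrow> \<one> A \<bottom> \<zero> A B"
    and perp_sym: "\<lbrakk>f \<in> hom A B; g \<in> hom A C; f \<bottom> g\<rbrakk> \<Longrightarrow> g \<bottom> f"
    and perp_self: "\<lbrakk>f \<in> hom A B; f \<bottom> f\<rbrakk> \<Longrightarrow> f = \<zero> A B"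
    and perp_le: "\<lbrakk>f \<in> hom A B; f' \<in> hom A B; g \<in> hom A C; g' \<in> hom A C;
      f' \<bottom> g'; f \<sqsubseteq> f'; g \<sqsubseteq> g'\<rbrakk> \<Longrightarrow> f \<bottom> g"
    and perp_cmp: "\<lbrakk>f \<in> hom A B; g \<in> hom A C; h \<in> hom A' A; k \<in> hom B B'; k' \<in> hom C C';
      f \<bottom> g\<rbrakk> \<Longrightarrow> h \<cdot> f \<cdot> k \<bottom> h \<cdot> g \<cdot> k'"
    and perp_rst: "\<lbrakk>f \<in> hom A B; g \<in> hom A C; f \<bottom> g\<rbrakk> \<Longrightarrow> \<rho> f \<bottom> \<rho> g"

end

theory Submission
  imports Defs
begin

text \<open>Everything comes from composing the two sides of an interference with different maps on
  the right (\<open>perp_cmp_right\<close>). Applied to 1 \<bottom> 0 it yields f \<bottom> 0.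
  Applied to \<rho> f \<bottom> \<rho> g with \<rho> g and \<rho> f, it makes the commuting product
  \<rho> f \<cdot> \<rho> g interfere with itself, so that product is zero
  (\<open>perp_rst_cmp_rst\<close>); the other vanishing products and the claim on total maps
  follow. Since \<rho> g \<cdot> g = g, a bar on one side of an interference can be removed
  (\<open>perp_rst_cancel_right\<close>); barring both sides and then removing one bar gives the
  one-sided versions.\<close>

context category
begin

lemma src_obj_hom: "f \<in> hom A B \<Longrightarrow> A \<in> obj X"
  using src_obj by (auto simp: hom_def)

lemma tgt_obj_hom: "f \<in> hom A B \<Longrightarrow> B \<in> obj X"
  using tgt_obj by (auto simp: hom_def)

end

context interference_relation
begin

text \<open>Take \<open>h\<close> to be the identity in \<open>perp_cmp\<close>.\<close>

lemma perp_cmp_right: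
  assumes "f \<in> hom A B" "g \<in> hom A C" "k \<in> hom B B'" "k' \<in> hom C C'" "f \<bottom> g"
  shows "f \<cdot> k \<bottom> g \<cdot> k'"
  using perp_cmp[OF assms(1,2) idn_hom assms(3-5)] src_obj_hom assms(1,2)
  by (simp add: idn_left)

lemma perp_zer:
  assumes "f \<in> hom A B" "C \<in> obj X"
  shows "f \<bottom> \<zero> A C"
proof -
  have A: "A \<in> obj X"
    using assms(1) by (rule src_obj_hom)
  \<comment> \<open>Start from \<open>perp_idn_zer\<close> and compose with \<open>f\<close> on one
    side and an identity on the other.\<close>
  have "\<one> A \<cdot> f \<bottom> \<zero> A C \<cdot> \<one> C"
    using A assms by (blast intro: perp_cmp_right idn_hom zer_hom perp_idn_zer)
  then show ?thesis
    using idn_left[OF assms(1)] idn_right[OF zer_hom[OF A assms(2)]] by simp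
qed

text \<open>Compose the right side with \<open>g\<close>, which turns \<rho> g into \<rho> g \<cdot>
  g = g. With \<open>perp_rst_right\<close> as converse, this gives the equivalence for restriction
  idempotents.\<close>

lemma perp_rst_cancel_right:
  assumes "f \<in> hom A B" "g \<in> hom A C" "f \<bottom> \<rho> g"
  shows "f \<bottom> g"
  using perp_cmp_right[OF assms(1) rst_hom[OF assms(2)] idn_hom assms(2,3)]
    tgt_obj_hom[OF assms(1)] idn_right[OF assms(1)] rst_cmp_self[OF assms(2)]
  by simp

lemma perp_rst_right:
  assumes "f \<in> hom A B" "g \<in> hom A C" "f \<bottom> g"
  shows "f \<bottom> \<rho> g"
proof -
  \<comment> \<open>Symmetry places \<rho> f on the right, where its bar can be cancelled.\<close>
  have "\<rho> g \<bottom> \<rho> f"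
    using perp_sym[OF rst_hom rst_hom perp_rst] assms by blast
  then have "\<rho> g \<bottom> f"
    using assms by (blast intro: perp_rst_cancel_right rst_hom)
  then show ?thesis
    using assms by (blast intro: perp_sym rst_hom)
qed

lemma perp_rst_left:
  assumes "f \<in> hom A B" "g \<in> hom A C" "f \<bottom> g"
  shows "\<rho> f \<bottom> g"
  using assms by (blast intro: perp_sym perp_rst_right rst_hom)

lemma perp_rst_cmp_rst:
  assumes "f \<in> hom A B" "g \<in> hom A C" "f \<bottom> g"
  shows "\<rho> f \<cdot> \<rho> g = \<zero> A A"
proof -
  have f: "\<rho> f \<in> hom A A" and g: "\<rho> g \<in> hom A A"
    using assms by (auto intro: rst_hom)
  \<comment> \<open>Composing crosswise makes the two sides equal up to commuting restrictions, so
    \<open>perp_self\<close> applies.\<close>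
  have "\<rho> f \<cdot> \<rho> g \<bottom> \<rho> g \<cdot> \<rho> f"
    using perp_cmp_right[OF f g g f] perp_rst assms by blast
  then have "\<rho> f \<cdot> \<rho> g \<bottom> \<rho> f \<cdot> \<rho> g"
    using rst_commute[OF assms(1,2)] by simp
  then show ?thesis
    using cmp_hom[OF f g] by (rule perp_self[rotated])
qed

text \<open>Writing g as \<rho> g \<cdot> g exposes the vanishing factor \<rho> f \<cdot> \<rho>
  g.\<close>

lemma perp_rst_cmp:
  assumes "f \<in> hom A B" "g \<in> hom A C" "f \<bottom> g"
  shows "\<rho> f \<cdot> g = \<zero> A C"
proof -
  have "\<rho> f \<cdot> g = \<rho> f \<cdot> \<rho> g \<cdot> g"
    using assoc[OF rst_hom[OF assms(1)] rst_hom[OF assms(2)] assms(2)]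
      rst_cmp_self[OF assms(2)] by simp
  also have "\<dots> = \<zero> A C"
    using perp_rst_cmp_rst[OF assms] zer_cmp[OF assms(2)] src_obj_hom[OF assms(1)] by simp
  finally show ?thesis .
qed

lemma total_perp_iff:
  assumes "f \<in> hom A B" "g \<in> hom A C" "total_map X f"
  shows "f \<bottom> g \<longleftrightarrow> g = \<zero> A C"
proof
  assume "f \<bottom> g"
  moreover have "\<rho> f = \<one> A"
    using assms(1,3) by (simp add: total_map_def hom_def)
  ultimately show "g = \<zero> A C"
    using perp_rst_cmp[OF assms(1,2)] idn_left[OF assms(2)] by simp
next
  assume "g = \<zero> A C"
  then show "f \<bottom> g"
    using perp_zer[OF assms(1)] tgt_obj_hom[OF assms(2)] by simp
qed

end

theorem lemma3p5:
  fixes X :: "('o, 'm, 'z) restriction_zero_category_scheme" (structure)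
    and perp :: "'m \<Rightarrow> 'm \<Rightarrow> bool"  (infix "\<bottom>" 50)
  assumes "interference_relation X (\<bottom>)"
  shows
    "(\<forall>A B C f. f \<in> hom A B \<and> C \<in> obj X \<longrightarrow> f \<bottom> \<zero> A C) \<and>
     (\<forall>A B C f g. f \<in> hom A B \<and> g \<in> hom A C \<longrightarrow> f \<bottom> g \<longrightarrow>
        \<rho> f \<cdot> g = \<zero> A C \<and> \<rho> g \<cdot> f = \<zero> A B \<and> \<rho> f \<cdot> \<rho> g = \<zero> A A) \<and>
     (\<forall>A B C f g. f \<in> hom A B \<and> g \<in> hom A C \<longrightarrow> total_map X f \<longrightarrow>
        (f \<bottom> g \<longleftrightarrow> g = \<zero> A C)) \<and>
     (\<forall>A B e f. e \<in> hom A A \<and> f \<in> hom A B \<longrightarrow> restriction_idempotent X e \<longrightarrow>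
        (e \<bottom> f \<longleftrightarrow> e \<bottom> \<rho> f)) \<and>
     (\<forall>A B C f g. f \<in> hom A B \<and> g \<in> hom A C \<longrightarrow> f \<bottom> g \<longrightarrow>
        f \<bottom> \<rho> g \<and> \<rho> f \<bottom> g)"
proof -
  interpret interference_relation X "(\<bottom>)"
    by (fact assms)
  show ?thesis
    by (intro conjI allI impI; (elim conjE)?)
      (blast intro: perp_zer perp_rst_cmp perp_rst_cmp_rst perp_sym perp_rst_right
        perp_rst_left perp_rst_cancel_right iffD1[OF total_perp_iff] iffD2[OF total_perp_iff])+
qed

end
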